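(* Let $0<q<1$ and $p\in\{0,1\}$. As formal Laurent series in $x$ with coefficients in $\mathbb{R}[y]$, $$\sum_{n,m}\pi_{[p]}(n,m)x^ny^m=\frac{1-q^2x^2}{(1-q)\,x\,\Big(1-q^2x^2-(1-q)\big(x+qx^2y^{[\![p=1]\!]}-q^2x^3(1-y^{[\![p=0]\!]})\big)\Big)}.$$
   Context: $[\![P]\!]$ is the Iverson bracket ($1$ if $P$ is true, $0$ otherwise). A random $n$-string is a binary string of length $n$ whose bits are independent, each equal to $1$ with probability $q$. A nonnull run of ones is a maximal block of consecutive ones of length at least $1$; it is a $p$-parity run if its length is congruent to $p$ modulo $2$. For $n\ge 0$, $\pi_{[p]}(n,m)$ is the probability that a random $n$-string contains exactly $m$ nonnull $p$-parity runs of ones. By convention $\pi_{[p]}(-1,m)=1/(1-q)$ if $m=0$ and $0$ otherwise, and $\pi_{[p]}(n,m)=0$ if $n<-1$ or $m<0$. The sum is over all integers $n,m$. *)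

theory Defs
  imports
    "HOL-Probability.Probability"
    "HOL-Computational_Algebra.Formal_Laurent_Series"
    "HOL-Computational_Algebra.Polynomial"
    "HOL-Library.Groups_Big_Fun"
    "HOL-Number_Theory.Cong"
begin

text \<open>The run occupies the positions \<open>i, ..., j - 1\<close> (counted from 0), so its length is \<open>j - i\<close>.\<close>

definition nonnull_run_of_ones :: "bool list \<Rightarrow> nat \<Rightarrow> nat \<Rightarrow> bool" where
  "nonnull_run_of_ones xs i j \<longleftrightarrow>
     i < j \<and> j \<le> length xs \<and> (\<forall>k\<in>{i..<j}. xs ! k) \<and>
     (i = 0 \<or> \<not> xs ! (i - 1)) \<and> (j = length xs \<or> \<not> xs ! j)"

definition parity_run_count :: "nat \<Rightarrow> bool list \<Rightarrow> nat" where
  "parity_run_count p xs =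
     card {(i, j). nonnull_run_of_ones xs i j \<and> [j - i = p] (mod 2)}"

definition random_string :: "real \<Rightarrow> nat \<Rightarrow> bool list pmf" where
  "random_string q n = replicate_pmf n (bernoulli_pmf q)"

definition parity_run_prob :: "real \<Rightarrow> nat \<Rightarrow> int \<Rightarrow> int \<Rightarrow> real" where
  "parity_run_prob q p n m =
     (if n < -1 \<or> m < 0 then 0
      else if n = -1 then (if m = 0 then 1 / (1 - q) else 0)
      else measure_pmf.prob (random_string q (nat n)) {xs. int (parity_run_count p xs) = m})"

text \<open>The coefficient of \<open>x\<^sup>n\<close> sums over all integers \<open>m\<close>; only finitely many terms are nonzero, and
  they all have \<open>m \<ge> 0\<close>, see below.\<close>

definition parity_run_series :: "real \<Rightarrow> nat \<Rightarrow> real poly fls" where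
  "parity_run_series q p =
     Abs_fls (\<lambda>n. Sum_any (\<lambda>m::int. monom (parity_run_prob q p n m) (nat m)))"

text \<open>\<open>a * b\<inverse>\<close> for a unit \<open>b\<close>. The ring of Laurent series over \<open>\<real>[y]\<close> is not a field, and the library's
  \<open>/\<close> on Laurent series needs a coefficient type with an \<open>inverse\<close> operation, which polynomials lack.\<close>

definition unit_quotient :: "'a::comm_ring_1 \<Rightarrow> 'a \<Rightarrow> 'a" where
  "unit_quotient a b = a * (THE c. b * c = 1)"

lemma unit_quotient_eq_iff:
  assumes "b dvd (1::'a::comm_ring_1)"
  shows "f = unit_quotient a b \<longleftrightarrow> f * b = a"
proof -
  obtain c where c: "b * c = 1" using assms by (metis dvdE)
  have u: "d = c" if "b * d = 1" for d
    using c that by (metis mult.assoc mult.commute mult_1)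
  have "(THE c. b * c = 1) = c" using c u by blast
  then show ?thesis unfolding unit_quotient_def using c
    by (metis mult.assoc mult.commute mult_1_right)
qed

lemma finite_parity_run_prob_support: "finite {m. parity_run_prob q p n m \<noteq> 0}"
proof -
  let ?S = "{xs::bool list. set xs \<subseteq> UNIV \<and> length xs = nat n}"
  have fin: "finite ?S" by (rule finite_lists_length_eq) simp
  have "{m. parity_run_prob q p n m \<noteq> 0} \<subseteq> insert 0 ((\<lambda>xs. int (parity_run_count p xs)) ` ?S)"
  proof
    fix m assume m: "m \<in> {m. parity_run_prob q p n m \<noteq> 0}"
    show "m \<in> insert 0 ((\<lambda>xs. int (parity_run_count p xs)) ` ?S)"
    proof (rule ccontr)
      assume c: "m \<notin> insert 0 ((\<lambda>xs. int (parity_run_count p xs)) ` ?S)"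
      have "set_pmf (random_string q (nat n)) \<inter> {xs. int (parity_run_count p xs) = m} = {}"
        using c by (auto simp: random_string_def set_replicate_pmf)
      then have "measure_pmf.prob (random_string q (nat n)) {xs. int (parity_run_count p xs) = m} = 0"
        by (simp add: measure_pmf_zero_iff)
      with m c show False by (auto simp: parity_run_prob_def split: if_splits)
    qed
  qed
  then show ?thesis using fin by (meson finite_imageI finite_insert finite_subset)
qed

lemma parity_run_series_nth:
  "fls_nth (parity_run_series q p) n = Sum_any (\<lambda>m::int. monom (parity_run_prob q p n m) (nat m))"
  unfolding parity_run_series_def
  by (rule nth_Abs_fls_lower_bound[of "-1"]) (simp add: parity_run_prob_def)

lemma coeff_parity_run_series:
  "coeff (fls_nth (parity_run_series q p) n) m = parity_run_prob q p n (int m)"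
proof -
  let ?A = "{m. parity_run_prob q p n m \<noteq> 0}"
  have "Sum_any (\<lambda>m::int. monom (parity_run_prob q p n m) (nat m))
      = (\<Sum>k\<in>?A. monom (parity_run_prob q p n k) (nat k))"
    by (rule Sum_any.expand_superset) (auto intro: finite_parity_run_prob_support)
  moreover have "coeff (\<Sum>k\<in>?A. monom (parity_run_prob q p n k) (nat k)) m
      = (\<Sum>k\<in>?A. if k = int m then parity_run_prob q p n k else 0)"
    unfolding coeff_sum by (rule sum.cong) (auto simp: parity_run_prob_def split: if_splits)
  ultimately show ?thesis
    by (simp add: parity_run_series_nth finite_parity_run_prob_support)
qed

end

theory Submission
  imports Defs
begin

text \<open>
  Let \<open>P\<^sub>n = \<Sum>\<^sub>m \<pi>(n, m) y\<^sup>m\<close> be the mean of \<open>y\<close> raised to the number of \<open>p\<close>-parity runs. A string of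
  length at least two starts with \<open>0\<close>, \<open>10\<close> or \<open>11\<close>. Removing a leading \<open>0\<close> keeps all runs; removing
  \<open>10\<close> destroys one run of length 1; removing \<open>11\<close> shortens the first run by two, which does not
  change its parity, unless that run is exactly \<open>11\<close>, in which case an even run disappears. This
  exceptional case occurs when the rest is empty or starts with \<open>0\<close>. Writing \<open>y\<^sub>1\<close> for \<open>y\<close> raised to
  \<open>[p = 1]\<close>, and \<open>y\<^sub>2\<close> for \<open>y\<close> raised to \<open>[p = 0]\<close>, this gives
  \<open>P\<^sub>n = (1 - q) P\<^sub>n\<^sub>-\<^sub>1 + q (1 - q) y\<^sub>1 P\<^sub>n\<^sub>-\<^sub>2 + q\<^sup>2 (P\<^sub>n\<^sub>-\<^sub>2 + (y\<^sub>2 - 1) (1 - q) P\<^sub>n\<^sub>-\<^sub>3)\<close>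
  (lemma \<open>parity_run_poly_rec\<close>). The convention \<open>P\<^sub>-\<^sub>1 = 1 / (1 - q)\<close> is what makes the last term
  correct for \<open>n = 2\<close>, where the rest is empty with probability 1.

  Read as an identity of power series, this recurrence says that the series times the
  denominator is the numerator; the numerator \<open>1 - q\<^sup>2 x\<^sup>2\<close> also collects the initial values
  (lemma \<open>parity_run_poly_fps\<close>). The numerator has constant coefficient 1, so it is a unit, and hence
  so is the denominator, which divides it.
\<close>

section \<open>Effect of the first bits on the runs\<close>

lemma nonnull_run_Cons_0:
  "nonnull_run_of_ones (b # xs) 0 j \<longleftrightarrow>
     b \<and> (j = 1 \<and> (xs = [] \<or> \<not> hd xs) \<or> (\<exists>k. j = Suc k \<and> nonnull_run_of_ones xs 0 k))"
proof (cases j)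
  case 0
  then show ?thesis by (simp add: nonnull_run_of_ones_def)
next
  case (Suc k)
  have "(\<forall>l\<in>{0..<Suc k}. (b # xs) ! l) \<longleftrightarrow> b \<and> (\<forall>l\<in>{0..<k}. xs ! l)"
    by (simp add: atLeast0LessThan lessThan_Suc_eq_insert_0)
  then show ?thesis
    using Suc by (cases "k = 0") (auto simp: nonnull_run_of_ones_def hd_conv_nth)
qed

lemma nonnull_run_Cons_Suc:
  "nonnull_run_of_ones (b # xs) (Suc i) j \<longleftrightarrow>
     (\<exists>k. j = Suc k \<and> nonnull_run_of_ones xs i k) \<and> (i = 0 \<longrightarrow> \<not> b)"
proof (cases j)
  case 0
  then show ?thesis by (simp add: nonnull_run_of_ones_def)
next
  case (Suc k)
  have "(\<forall>l\<in>{Suc i..<Suc k}. (b # xs) ! l) \<longleftrightarrow> (\<forall>l\<in>{i..<k}. xs ! l)"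
    by (simp flip: image_Suc_atLeastLessThan)
  then show ?thesis
    using Suc by (cases "i = 0") (auto simp: nonnull_run_of_ones_def nth_Cons')
qed

lemmas nonnull_run_Cons = nonnull_run_Cons_0 nonnull_run_Cons_Suc

definition parity_runs :: "nat \<Rightarrow> bool list \<Rightarrow> (nat \<times> nat) set" where
  "parity_runs p xs = {(i, j). nonnull_run_of_ones xs i j \<and> [j - i = p] (mod 2)}"

lemma parity_run_count_eq_card: "parity_run_count p xs = card (parity_runs p xs)"
  by (simp add: parity_run_count_def parity_runs_def)

lemma finite_parity_runs: "finite (parity_runs p xs)"
  by (rule finite_subset[of _ "{..length xs} \<times> {..length xs}"])
     (auto simp: parity_runs_def nonnull_run_of_ones_def)

lemma parity_runs_end_pos: "(i, j) \<in> parity_runs p xs \<Longrightarrow> 0 < j"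
  by (auto simp: parity_runs_def nonnull_run_of_ones_def)

lemma nonnull_run_Nil: "\<not> nonnull_run_of_ones [] i j"
  by (simp add: nonnull_run_of_ones_def)

lemma parity_run_count_Nil: "parity_run_count p [] = 0"
  by (simp add: parity_run_count_def nonnull_run_Nil)

lemma parity_run_count_False: "parity_run_count p (False # xs) = parity_run_count p xs"
proof -
  have "parity_runs p (False # xs) = (\<lambda>(i, j). (Suc i, Suc j)) ` parity_runs p xs"
  proof (intro set_eqI)
    fix z :: "nat \<times> nat"
    obtain i j where z: "z = (i, j)" by force
    show "z \<in> parity_runs p (False # xs) \<longleftrightarrow> z \<in> (\<lambda>(i, j). (Suc i, Suc j)) ` parity_runs p xs"
      unfolding z by (cases i) (auto simp: parity_runs_def image_iff nonnull_run_Cons)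
  qed
  moreover have "inj (\<lambda>(i, j). (Suc i, Suc j))" by (auto simp: inj_def)
  ultimately show ?thesis
    by (simp add: parity_run_count_eq_card card_image inj_on_subset)
qed

lemma parity_run_count_True: "parity_run_count p [True] = of_bool [1 = p] (mod 2)"
proof -
  have "nonnull_run_of_ones [True] i j \<longleftrightarrow> (i, j) = (0, 1)" for i j
    by (cases i) (auto simp: nonnull_run_Cons nonnull_run_Nil)
  then have "parity_runs p [True] = (if [1 = p] (mod 2) then {(0, 1)} else {})"
    by (auto simp: parity_runs_def)
  then show ?thesis by (simp add: parity_run_count_eq_card)
qed

text \<open>The leading \<open>10\<close> contributes the run \<open>(0, 1)\<close>; the zero separates it from all other runs, which are
  merely translated by two positions.\<close>

lemma parity_run_count_True_False:
  "parity_run_count p (True # False # xs) = of_bool [1 = p] (mod 2) + parity_run_count p xs"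
proof -
  define f :: "nat \<times> nat \<Rightarrow> nat \<times> nat" where "f = (\<lambda>(i, j). (i + 2, j + 2))"
  have inj: "inj f" by (auto simp: inj_def f_def)
  have "parity_runs p (True # False # xs) =
          (if [1 = p] (mod 2) then {(0, 1)} else {}) \<union> f ` parity_runs p xs"
  proof (intro set_eqI)
    fix z :: "nat \<times> nat"
    obtain i j where z: "z = (i, j)" by force
    consider "i = 0" | "i = 1" | k where "i = Suc (Suc k)" by (metis One_nat_def not0_implies_Suc)
    then show "z \<in> parity_runs p (True # False # xs) \<longleftrightarrow>
          z \<in> (if [1 = p] (mod 2) then {(0, 1)} else {}) \<union> f ` parity_runs p xs"
      unfolding z by cases (auto simp: f_def parity_runs_def image_iff nonnull_run_Cons)
  qed
  moreover have "(0, 1) \<notin> f ` parity_runs p xs" by (auto simp: f_def)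
  ultimately show ?thesis
    by (simp add: parity_run_count_eq_card card_image[OF inj_on_subset[OF inj]] finite_parity_runs)
qed

text \<open>A run at the start of \<open>xs\<close> absorbs the two new ones and keeps its parity; when there is none, the
  two new ones form a run of their own, which is even.\<close>

lemma parity_run_count_True_True:
  "parity_run_count p (True # True # xs) =
     of_bool ([2 = p] (mod 2) \<and> (xs = [] \<or> \<not> hd xs)) + parity_run_count p xs"
proof -
  \<comment> \<open>A run at the start is extended to the left, every other run is translated.\<close>
  define f :: "nat \<times> nat \<Rightarrow> nat \<times> nat"
    where "f = (\<lambda>(i, j). (if i = 0 then 0 else i + 2, j + 2))"
  have inj: "inj f" by (auto simp: inj_def f_def split: if_splits)
  let ?new = "if [2 = p] (mod 2) \<and> (xs = [] \<or> \<not> hd xs) then {(0, Suc (Suc 0))} else {}"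
  have cong: "[Suc (Suc k) = p] (mod 2) \<longleftrightarrow> [k = p] (mod 2)" for k
    by (simp add: cong_def)
  have cong2: "[2 = p] (mod 2) \<longleftrightarrow> [0 = p] (mod 2)"
    by (simp add: cong_def)
  have image: "(i, j) \<in> f ` S \<longleftrightarrow> (\<exists>k. j = Suc (Suc k) \<and>
      (i = 0 \<and> (0, k) \<in> S \<or> (\<exists>l>0. i = Suc (Suc l) \<and> (l, k) \<in> S)))" for i j S
    by (force simp: f_def image_iff split: if_splits)
  have "parity_runs p (True # True # xs) = ?new \<union> f ` parity_runs p xs"
  proof (intro set_eqI)
    fix z :: "nat \<times> nat"
    obtain i j where z: "z = (i, j)" by force
    consider "i = 0" | "i = 1" | k where "i = Suc (Suc k)" by (metis One_nat_def not0_implies_Suc)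
    then show "z \<in> parity_runs p (True # True # xs) \<longleftrightarrow> z \<in> ?new \<union> f ` parity_runs p xs"
    proof cases
      case 1
      then show ?thesis unfolding z Un_iff image
        by (auto simp: parity_runs_def nonnull_run_Cons cong cong2 nonnull_run_Nil)
    next
      case 2
      then show ?thesis unfolding z Un_iff image
        by (auto simp: parity_runs_def nonnull_run_Cons)
    next
      case (3 k)
      then show ?thesis unfolding z Un_iff image
        by (auto simp: parity_runs_def nonnull_run_Cons)
    qed
  qed
  moreover have "(0, Suc (Suc 0)) \<notin> f ` parity_runs p xs" by (auto simp: f_def dest: parity_runs_end_pos)
  ultimately show ?thesis
    by (simp add: parity_run_count_eq_card card_image[OF inj_on_subset[OF inj]] finite_parity_runs)
qed

section \<open>Means over random strings\<close>

text \<open>The expectation of \<open>h\<close> over a random \<open>n\<close>-string. Real polynomials carry no complete norm, so this is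
  not an integral; the recursion also makes conditioning on the first bit the defining equation.\<close>

fun string_mean :: "real \<Rightarrow> nat \<Rightarrow> (bool list \<Rightarrow> real poly) \<Rightarrow> real poly" where
  "string_mean q 0 h = h []"
| "string_mean q (Suc n) h =
     smult q (string_mean q n (\<lambda>xs. h (True # xs))) +
     smult (1 - q) (string_mean q n (\<lambda>xs. h (False # xs)))"

lemma string_mean_add:
  "string_mean q n (\<lambda>xs. g xs + h xs) = string_mean q n g + string_mean q n h"
  by (induction n arbitrary: g h) (simp_all add: smult_add_right algebra_simps)

lemma string_mean_mult: "string_mean q n (\<lambda>xs. c * h xs) = c * string_mean q n h"
  by (induction n arbitrary: h) (simp_all add: algebra_simps)

lemma prob_random_string_Suc:
  assumes "0 \<le> q" "q \<le> 1"
  shows "measure_pmf.prob (random_string q (Suc n)) A =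
    q * measure_pmf.prob (random_string q n) {xs. True # xs \<in> A} +
    (1 - q) * measure_pmf.prob (random_string q n) {xs. False # xs \<in> A}"
proof -
  have "random_string q (Suc n) =
     bernoulli_pmf q \<bind> (\<lambda>b. map_pmf (Cons b) (random_string q n))"
    by (simp add: random_string_def map_pmf_def)
  moreover have "Cons b -` A = {xs. b # xs \<in> A}" for b by auto
  ultimately have "emeasure (measure_pmf (random_string q (Suc n))) A =
     ennreal (measure_pmf.prob (random_string q n) {xs. True # xs \<in> A}) * ennreal q +
     ennreal (measure_pmf.prob (random_string q n) {xs. False # xs \<in> A}) * ennreal (1 - q)"
    using assms by (simp flip: measure_pmf.emeasure_eq_measure)
  also have "\<dots> = ennreal (q * measure_pmf.prob (random_string q n) {xs. True # xs \<in> A} +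
    (1 - q) * measure_pmf.prob (random_string q n) {xs. False # xs \<in> A})"
    using assms by (simp add: ennreal_mult mult.commute)
  finally show ?thesis using assms by (simp add: measure_pmf.emeasure_eq_measure del: ennreal_plus)
qed

text \<open>Links the purely algebraic mean to probabilities: it is a probability generating function.\<close>

lemma coeff_string_mean:
  assumes "0 \<le> q" "q \<le> 1"
  shows "coeff (string_mean q n (\<lambda>xs. monom 1 (f xs))) m =
           measure_pmf.prob (random_string q n) {xs. f xs = m}"
proof (induction n arbitrary: f)
  case 0
  then show ?case by (simp add: random_string_def)
next
  case (Suc n)
  then show ?case using assms by (simp add: prob_random_string_Suc)
qed

text \<open>The index is shifted by one: \<open>parity_run_poly q p k\<close> belongs to strings of length \<open>k - 1\<close>, so that index
  \<open>0\<close> carries the conventional value for length \<open>-1\<close>.\<close>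

fun parity_run_poly :: "real \<Rightarrow> nat \<Rightarrow> nat \<Rightarrow> real poly" where
  "parity_run_poly q p 0 = [:1 / (1 - q):]"
| "parity_run_poly q p (Suc n) = string_mean q n (\<lambda>xs. monom 1 (parity_run_count p xs))"

text \<open>For \<open>n > 0\<close> the first bit is \<open>0\<close> with probability \<open>1 - q\<close> and can then be removed. For \<open>n = 0\<close> the left side
  is \<open>1\<close>, and the conventional value \<open>1 / (1 - q)\<close> is chosen to give \<open>1\<close> on the right as well.\<close>

lemma string_mean_zero_first:
  assumes "q \<noteq> 1"
  shows "string_mean q n
      (\<lambda>xs. if xs = [] \<or> \<not> hd xs then monom 1 (parity_run_count p xs) else 0) =
    smult (1 - q) (parity_run_poly q p n)"
proof (cases n)
  case 0
  then show ?thesis using assms by (simp add: parity_run_count_Nil monom_0 one_pCons)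
next
  case (Suc k)
  have "string_mean q k (\<lambda>xs. 0) = 0" by (induction k) simp_all
  then show ?thesis using Suc by (simp add: parity_run_count_False)
qed

text \<open>The three groups of terms come from the prefixes \<open>0\<close>, \<open>10\<close> and \<open>11\<close>. In the last one, the factor
  \<open>y - 1\<close> corrects the count for the strings in which the prefix is a run of its own.\<close>

lemma parity_run_poly_rec:
  assumes "q \<noteq> 1"
  defines "y \<equiv> monom (1 :: real) 1"
  shows "parity_run_poly q p (n + 3) =
    smult (1 - q) (parity_run_poly q p (n + 2)) +
    smult (q * (1 - q)) (y ^ of_bool [1 = p] (mod 2) * parity_run_poly q p (n + 1)) +
    smult (q\<^sup>2) (parity_run_poly q p (n + 1)) +
    smult (q\<^sup>2 * (1 - q)) ((y ^ of_bool [2 = p] (mod 2) - 1) * parity_run_poly q p n)"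
proof -
  define c where "c = parity_run_count p"
  define M where "M = string_mean q n"
  let ?y1 = "y ^ of_bool [1 = p] (mod 2)" and ?y2 = "y ^ of_bool [2 = p] (mod 2)"
  have y_pow: "monom 1 k = y ^ k" for k
    by (simp add: y_def monom_power)
  have TF: "M (\<lambda>xs. monom 1 (c (True # False # xs))) = ?y1 * parity_run_poly q p (n + 1)"
    by (simp add: c_def M_def parity_run_count_True_False y_pow power_add
        flip: string_mean_mult)
  have "monom 1 (c (True # True # xs)) = monom 1 (c xs) +
      (?y2 - 1) * (if xs = [] \<or> \<not> hd xs then monom 1 (c xs) else 0)" for xs
    by (simp add: c_def parity_run_count_True_True y_pow algebra_simps)
  then have "M (\<lambda>xs. monom 1 (c (True # True # xs))) = M (\<lambda>xs. monom 1 (c xs)) +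
      (?y2 - 1) * M (\<lambda>xs. if xs = [] \<or> \<not> hd xs then monom 1 (c xs) else 0)"
    by (simp only: M_def string_mean_add string_mean_mult)
  also have "M (\<lambda>xs. monom 1 (c xs)) = parity_run_poly q p (n + 1)"
    by (simp add: M_def c_def)
  also have "M (\<lambda>xs. if xs = [] \<or> \<not> hd xs then monom 1 (c xs) else 0) =
      smult (1 - q) (parity_run_poly q p n)"
    using assms(1) unfolding M_def c_def by (rule string_mean_zero_first)
  finally have TT: "M (\<lambda>xs. monom 1 (c (True # True # xs))) =
      parity_run_poly q p (n + 1) + (?y2 - 1) * smult (1 - q) (parity_run_poly q p n)" .
  have "parity_run_poly q p (n + 3) = smult q (smult q (M (\<lambda>xs. monom 1 (c (True # True # xs)))) +
      smult (1 - q) (M (\<lambda>xs. monom 1 (c (True # False # xs))))) +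
      smult (1 - q) (parity_run_poly q p (n + 2))"
    by (simp add: c_def M_def numeral_3_eq_3 parity_run_count_False)
  also have "\<dots> = smult (1 - q) (parity_run_poly q p (n + 2)) +
    smult (q * (1 - q)) (?y1 * parity_run_poly q p (n + 1)) +
    smult (q\<^sup>2) (parity_run_poly q p (n + 1)) +
    smult (q\<^sup>2 * (1 - q)) ((?y2 - 1) * parity_run_poly q p n)"
    unfolding TF TT by (simp add: smult_add_right power2_eq_square mult.assoc)
  finally show ?thesis .
qed

lemma parity_run_poly_1: "parity_run_poly q p 1 = 1"
  by (simp add: parity_run_count_Nil)

lemma parity_run_poly_2:
  "parity_run_poly q p 2 = smult (1 - q) 1 + smult q (monom 1 1 ^ of_bool [1 = p] (mod 2))"
  by (simp add: numeral_2_eq_2 parity_run_count_Nil parity_run_count_True parity_run_count_False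
      monom_power)

section \<open>Generating function\<close>

lemma X_times_parity_run_series:
  assumes "0 \<le> q" "q \<le> 1"
  shows "fls_X * parity_run_series q p = fps_to_fls (Abs_fps (parity_run_poly q p))"
proof (intro fls_eqI poly_eqI)
  fix n :: int and m :: nat
  consider "n < 0" | "n = 0" | k where "n = int (Suc k)"
    by (metis linorder_cases pos_int_cases old.nat.exhaust of_nat_0)
  then have "parity_run_prob q p (n - 1) (int m) =
      coeff (if n < 0 then 0 else parity_run_poly q p (nat n)) m"
    using assms
    by cases (auto simp: parity_run_prob_def coeff_string_mean nat_add_distrib coeff_pCons
        split: nat.splits)
  then show "coeff (fls_nth (fls_X * parity_run_series q p) n) m =
      coeff (fls_nth (fps_to_fls (Abs_fps (parity_run_poly q p))) n) m"
    by (simp add: fls_X_times_conv_shift coeff_parity_run_series)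
qed

text \<open>From the coefficient of \<open>x\<^sup>3\<close> on, this is the recurrence; the coefficients below it give the numerator.
  In particular the coefficient \<open>- q\<^sup>2\<close> of \<open>x\<^sup>2\<close> arises because the prefix \<open>11\<close> is impossible for strings of
  length one, although the denominator subtracts its contribution from the conventional value.\<close>

lemma parity_run_poly_fps:
  fixes q :: real
  assumes "q \<noteq> 1"
  defines "Q \<equiv> fps_const [:q:]" and "y \<equiv> fps_const (monom (1::real) 1)"
  shows "Abs_fps (parity_run_poly q p) * ((1 - Q) *
           (1 - Q^2 * fps_X^2 - (1 - Q) * (fps_X + Q * fps_X^2 * y ^ of_bool [1 = p] (mod 2)
              - Q^2 * fps_X^3 * (1 - y ^ of_bool [2 = p] (mod 2))))) = 1 - Q^2 * fps_X^2"
proof -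
  define P where "P = parity_run_poly q p"
  define A where "A = Abs_fps P"
  define y1 y2 where "y1 = monom (1::real) 1 ^ of_bool [1 = p] (mod 2)"
    and "y2 = monom (1::real) 1 ^ of_bool [2 = p] (mod 2)"
  define r where "r = [:q:]"
  have Q: "Q = fps_const r" by (simp add: Q_def r_def)
  have Q1: "1 - Q = fps_const (1 - r)"
    by (simp add: Q flip: fps_const_1_eq_1)
  have smult_q: "smult q a = r * a" and smult_1q: "smult (1 - q) a = (1 - r) * a" for a
    by (simp_all add: r_def one_pCons)
  have P0: "(1 - r) * P 0 = 1"
    using assms(1) by (simp add: r_def P_def one_pCons)
  have P1: "P 1 = 1"
    unfolding P_def by (rule parity_run_poly_1)
  have P2: "P 2 = (1 - r) + r * y1"
    unfolding P_def parity_run_poly_2 using smult_1q[of 1] by (simp add: smult_q y1_def)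
  have P3: "P (n + 3) = (1 - r) * P (n + 2) + r * (1 - r) * y1 * P (n + 1) + r^2 * P (n + 1)
      + r^2 * (1 - r) * (y2 - 1) * P n" for n
    unfolding P_def parity_run_poly_rec[OF assms(1)] y1_def y2_def
    by (simp add: smult_q smult_1q power2_eq_square mult.assoc flip: smult_smult)
  have y1_eq: "y ^ of_bool [1 = p] (mod 2) = fps_const y1"
    by (simp add: y1_def y_def)
  have y2_eq: "y ^ of_bool [2 = p] (mod 2) = fps_const y2"
    by (simp add: y2_def y_def)
  have "A * ((1 - Q) *
           (1 - Q^2 * fps_X^2 - (1 - Q) * (fps_X + Q * fps_X^2 * y ^ of_bool [1 = p] (mod 2)
              - Q^2 * fps_X^3 * (1 - y ^ of_bool [2 = p] (mod 2))))) =
     (1 - Q) * (A - Q^2 * (fps_X^2 * A) - (1 - Q) * (fps_X^1 * A)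
        - (1 - Q) * (Q * (fps_const y1 * (fps_X^2 * A)))
        - (1 - Q) * (Q^2 * (fps_const (y2 - 1) * (fps_X^3 * A))))" (is "_ = ?R")
    unfolding y1_eq y2_eq by (simp add: algebra_simps flip: fps_const_sub)
  also have "?R = 1 - Q^2 * fps_X^2"
  proof (rule fps_ext)
    fix n :: nat
    consider "n = 0" | "n = 1" | "n = 2" | k where "n = k + 3"
    proof -
      have "n \<in> {0, 1, 2} \<or> n = (n - 3) + 3" by auto
      then show thesis using that by blast
    qed
    then show "fps_nth ?R n = fps_nth (1 - Q^2 * fps_X^2) n"
    proof cases
      case 1
      then show ?thesis unfolding Q1 unfolding Q A_def
        by (simp add: fps_X_power_mult_nth P0)
    next
      case 2
      then show ?thesis using P0 P1 unfolding Q1 unfolding Q A_def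
        by (simp add: fps_X_power_mult_nth)
    next
      case 3
      have "(1 - r) * (P 2 - r^2 * P 0 - (1 - r) * P 1 - (1 - r) * (r * (y1 * P 0))) = - (r^2)"
        using P0 P1 P2 by algebra
      then show ?thesis using 3 unfolding Q1 unfolding Q A_def
        by (simp add: fps_X_power_mult_nth)
    next
      case (4 k)
      have "P (k + 3) - r^2 * P (k + 1) - (1 - r) * P (k + 2) - (1 - r) * (r * (y1 * P (k + 1)))
          - (1 - r) * (r^2 * ((y2 - 1) * P k)) = 0"
        unfolding P3 by algebra
      then show ?thesis using 4 unfolding Q1 unfolding Q A_def
        by (simp add: fps_X_power_mult_nth)
    qed
  qed
  finally show ?thesis by (simp add: A_def P_def)
qed

lemma one_minus_X_squared_dvd_one:
  fixes a :: "'a::comm_ring_1"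
  shows "1 - fps_const a * fps_X^2 dvd (1 :: 'a fps)"
proof (rule dvdI)
  let ?f = "1 - fps_const a * fps_X^2"
  show "1 = ?f * fps_right_inverse ?f 1"
    by (rule fps_right_inverse[symmetric]) simp
qed

theorem mainTheorem12:
  fixes q :: real and p :: nat
  assumes "0 < q" and "q < 1" and "p \<in> {0, 1}"
  shows "let Q = fls_const [:q:] :: real poly fls;
             x = fls_X :: real poly fls;
             y = fls_const (monom 1 1) :: real poly fls;
             N = 1 - Q^2 * x^2;
             D = (1 - Q) * x *
                 (1 - Q^2 * x^2
                  - (1 - Q) * (x + Q * x^2 * y ^ of_bool (p = 1)
                               - Q^2 * x^3 * (1 - y ^ of_bool (p = 0))))
         in D dvd 1 \<and> parity_run_series q p = unit_quotient N D"
proof -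
  define Q where "Q = fps_const [:q:]"
  define y where "y = fps_const (monom (1::real) 1)"
  define E where "E = (1 - Q) *
           (1 - Q^2 * fps_X^2 - (1 - Q) * (fps_X + Q * fps_X^2 * y ^ of_bool (p = 1)
              - Q^2 * fps_X^3 * (1 - y ^ of_bool (p = 0))))"
  define F where "F = parity_run_series q p"
  have par: "[1 = p] (mod 2) \<longleftrightarrow> p = 1" "[2 = p] (mod 2) \<longleftrightarrow> p = 0"
    using assms(3) by (auto simp: cong_def)
  have AE: "Abs_fps (parity_run_poly q p) * E = 1 - Q^2 * fps_X^2"
    using parity_run_poly_fps[of q p] assms unfolding E_def Q_def y_def par by simp
  have N: "fps_to_fls (1 - Q^2 * fps_X^2) = 1 - (fls_const [:q:])^2 * fls_X^2"
    by (simp add: Q_def fls_times_fps_to_fls fls_const_power fps_to_fls_power)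
  have D: "fls_X * fps_to_fls E = (1 - fls_const [:q:]) * fls_X *
      (1 - (fls_const [:q:])^2 * fls_X^2 - (1 - fls_const [:q:]) *
        (fls_X + fls_const [:q:] * fls_X^2 * fls_const (monom 1 1) ^ of_bool (p = 1)
           - (fls_const [:q:])^2 * fls_X^3 * (1 - fls_const (monom 1 1) ^ of_bool (p = 0))))"
    by (simp add: E_def Q_def y_def fls_times_fps_to_fls fls_const_power fps_to_fls_power mult_ac)
  have "F * (fls_X * fps_to_fls E) = fps_to_fls (Abs_fps (parity_run_poly q p)) * fps_to_fls E"
    using X_times_parity_run_series[of q p] assms by (simp add: F_def mult_ac)
  then have FD: "F * (fls_X * fps_to_fls E) = fps_to_fls (1 - Q^2 * fps_X^2)"
    by (simp only: AE flip: fls_times_fps_to_fls)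
  have "fls_X * fps_to_fls E dvd fps_to_fls (1 - Q^2 * fps_X^2)"
    unfolding FD[symmetric] by simp
  moreover obtain G where "1 = (1 - Q^2 * fps_X^2) * G"
    using one_minus_X_squared_dvd_one[of "[:q^2:]"]
    by (auto simp: Q_def poly_const_pow)
  then have "fps_to_fls (1 - Q^2 * fps_X^2) dvd 1"
    by (metis dvd_def fls_times_fps_to_fls fps_one_to_fls)
  ultimately have unit: "fls_X * fps_to_fls E dvd 1" by (rule dvd_trans)
  have "F = unit_quotient (fps_to_fls (1 - Q^2 * fps_X^2)) (fls_X * fps_to_fls E)"
    using unit_quotient_eq_iff[OF unit] FD by blast
  then show ?thesis using unit unfolding Let_def D N F_def by blast
qed

end
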